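(* Let $m\ge1$ be an integer and let $x_0<x_1<\cdots<x_m$ be real numbers with $x_m-x_0<\frac{2\pi h}{\ln(1+h)}$ and $(x_j-x_0)/h\in\mathbb{N}$ for $j=1,2,\ldots,m$. Then for every function $f:\mathbb{R}\to\mathbb{C}$, $$[x_0,\ldots,x_m;h]_tf=(2i)^{m-1}\frac{e_h^{-i(m-1)(m-4)h/4}}{A_h^{m-1}}\int_{x_0}^{x_m}T_{0,m}(y;h)\,(L_mf)(y-(m-1)h)\,d_hy,$$ where $$A_h^{k}=\begin{cases}1,&k=0,\\ \left(e_h^{ih}/h\right)^k\left(1-e_h^{-ih}\right)\left(1-e_h^{-2ih}\right)\cdots\left(1-e_h^{-kih}\right),&k\ne0.\end{cases}$$
   Context: Fix a real number $h\neq 0$, $h>-1$. For real $x$ put $e_h^{ix}=(1+h)^{ix/h}=\exp\left(ix\frac{\ln(1+h)}{h}\right)$, $\cos_h x=\frac{e_h^{ix}+e_h^{-ix}}{2}$, $\sin_h x=\frac{e_h^{ix}-e_h^{-ix}}{2i}$. The $h$-derivative is $\Delta_hf(x)=\frac{f(x+h)-f(x)}{h}$, and $I$ is the identity operator. $h$-integral: if $b-a\in h\mathbb{Z}$, $\int_a^bf(x)\,d_hx$ equals $h\left(f(a)+f(a+h)+\cdots+f(b-h)\right)$ if $a<b$, $0$ if $a=b$, and $-h\left(f(b)+f(b+h)+\cdots+f(a-h)\right)$ if $a>b$. Difference operator: $L_0=I$ and $L_m=\prod_{j=0}^{m-1}\left(\Delta_h-\frac{e_h^{i(j-(m-1)/2)h}-1}{h}I\right)$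 for $m\ge1$. For functions $\varphi_0,\dots,\varphi_m$ and points $x_0,\dots,x_m$, $\det\begin{pmatrix}\varphi_0&\cdots&\varphi_m\\ x_0&\cdots&x_m\end{pmatrix}$ denotes the determinant of the matrix whose row $r$ is $(\varphi_0(x_r),\dots,\varphi_m(x_r))$, $r=0,\dots,m$. $h$-trigonometric divided difference: for $m\ge1$, $x_0<\cdots<x_m$ with $x_m-x_0<\frac{2\pi h}{\ln(1+h)}$ and a function $f$ defined at the nodes, $$[x_0,\ldots,x_m;h]_t f=2^{m-1}\frac{\det\begin{pmatrix}1&\cos_h x&\sin_h x&\cdots&\cos_h nx&\sin_h nx&f(x)\\ x_0&x_1&x_2&\cdots&x_{m-2}&x_{m-1}&x_m\end{pmatrix}}{\det\begin{pmatrix}\cos_h\frac x2&\sin_h\frac x2&\cdots&\cos_h(n+\frac12)x&\sin_h(n+\frac12)x\\ x_0&x_1&\cdots&x_{m-1}&x_m\end{pmatrix}}\quad\text{if } m=2n+1,$$ $$[x_0,\ldots,x_m;h]_t f=2^{m}\frac{\det\begin{pmatrix}\cos_h\frac x2&\sin_h\frac x2&\cdots&\cos_h(n-\frac12)x&\sin_h(n-\frac12)x&f(x)\\ x_0&x_1&\cdots&x_{m-2}&x_{m-1}&x_m\end{pmatrix}}{\det\begin{pmatrix}1&\cos_h x&\sin_h x&\cdots&\cos_h nx&\sin_h nx\\ x_0&x_1&x_2&\cdots&x_{m-1}&x_m\end{pmatrix}}\quad\text{if } m=2n.$$ $h$-truncated power: for $m\ge 1$, $\left(\sin_h\frac{y-x}{2}\right)_+^{m-1}=\prod_{l=0}^{m-2}\sin_h\left(\frac{y-(x-lh)}{2}\right)$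 if $y>x$ (empty product $1$ for $m=1$), and $0$ if $y\le x$. For $m\ge1$, $T_{0,m}(x;h)=[x_0,\ldots,x_m;h]_t\left(\sin_h\frac{y-x}{2}\right)_+^{m-1}$, the divided difference being taken with respect to $y$. *)

theory Defs
  imports Complex_Main "Jordan_Normal_Form.Determinant"
begin

text \<open>Throughout, the parameter \<open>h\<close> is meant to satisfy \<open>h \<noteq> 0\<close> and \<open>h > -1\<close>.\<close>

text \<open>\<open>h_exp h x\<close> is $e_h^{ix} = (1+h)^{ix/h}$, i.e. the imaginary unit is built in.\<close>

definition h_exp :: "real \<Rightarrow> real \<Rightarrow> complex" where
  "h_exp h x = exp (\<i> * of_real x * of_real (ln (1 + h) / h))"

definition h_cos :: "real \<Rightarrow> real \<Rightarrow> complex" where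
  "h_cos h x = (h_exp h x + h_exp h (- x)) / 2"

definition h_sin :: "real \<Rightarrow> real \<Rightarrow> complex" where
  "h_sin h x = (h_exp h x - h_exp h (- x)) / (2 * \<i>)"

definition h_deriv :: "real \<Rightarrow> (real \<Rightarrow> complex) \<Rightarrow> real \<Rightarrow> complex" where
  "h_deriv h f x = (f (x + h) - f x) / of_real h"

text \<open>The \<open>h\<close>-integral is only meaningful if \<open>b - a\<close> is an integer multiple of \<open>h\<close>; then
  the floors below are exact, and the sums run over \<open>a, a + h, \<dots>, b - h\<close> and
  over \<open>b, b + h, \<dots>, a - h\<close>, respectively.\<close>

definition h_integral :: "real \<Rightarrow> real \<Rightarrow> real \<Rightarrow> (real \<Rightarrow> complex) \<Rightarrow> complex" where
  "h_integral h a b f =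
    (if a < b then of_real h * (\<Sum>k < nat \<lfloor>(b - a) / h\<rfloor>. f (a + real k * h))
     else if a = b then 0
     else - of_real h * (\<Sum>k < nat \<lfloor>(a - b) / h\<rfloor>. f (b + real k * h)))"

text \<open>One factor $\Delta_h - cI$.\<close>

definition h_factor :: "real \<Rightarrow> complex \<Rightarrow> (real \<Rightarrow> complex) \<Rightarrow> real \<Rightarrow> complex" where
  "h_factor h c f = (\<lambda>x. h_deriv h f x - c * f x)"

text \<open>The product of operators is composition; the factors commute, so the order chosen here
  (\<open>j = 0\<close> is applied first) is immaterial. For \<open>m = 0\<close> this is the identity.\<close>

definition h_diff_op :: "real \<Rightarrow> nat \<Rightarrow> (real \<Rightarrow> complex) \<Rightarrow> real \<Rightarrow> complex" where
  "h_diff_op h m f =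
    fold (\<lambda>j. h_factor h ((h_exp h ((real j - (real m - 1) / 2) * h) - 1) / of_real h)) [0..<m] f"

text \<open>\<open>coll_det m \<phi> x\<close> is the determinant of the matrix of size \<open>m + 1\<close> with row \<open>r\<close> equal to
  $(\varphi_0(x_r), \dots, \varphi_m(x_r))$.\<close>

definition coll_det :: "nat \<Rightarrow> (nat \<Rightarrow> real \<Rightarrow> complex) \<Rightarrow> (nat \<Rightarrow> real) \<Rightarrow> complex" where
  "coll_det m \<phi> x = det (mat (m + 1) (m + 1) (\<lambda>(r, c). \<phi> c (x r)))"

text \<open>The system $1, \cos_h x, \sin_h x, \cos_h 2x, \sin_h 2x, \dots$, indexed from \<open>0\<close>.\<close>

definition trig_int :: "real \<Rightarrow> nat \<Rightarrow> real \<Rightarrow> complex" where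
  "trig_int h c x =
    (if c = 0 then 1
     else if odd c then h_cos h (real ((c + 1) div 2) * x)
     else h_sin h (real (c div 2) * x))"

text \<open>The system
  $\cos_h \frac{x}{2}, \sin_h \frac{x}{2}, \cos_h \frac{3x}{2}, \sin_h \frac{3x}{2}, \dots$,
  indexed from \<open>0\<close>.\<close>

definition trig_half :: "real \<Rightarrow> nat \<Rightarrow> real \<Rightarrow> complex" where
  "trig_half h c x =
    (if even c then h_cos h ((real (c div 2) + 1 / 2) * x)
     else h_sin h ((real (c div 2) + 1 / 2) * x))"

text \<open>The divided difference at the nodes \<open>x 0 < \<dots> < x m\<close>, for \<open>m \<ge> 1\<close>. In the numerators
  the column with index \<open>m\<close> (the last one) is \<open>f\<close>.\<close>

definition h_trig_divdiff :: "real \<Rightarrow> nat \<Rightarrow> (nat \<Rightarrow> real) \<Rightarrow> (real \<Rightarrow> complex) \<Rightarrow> complex" where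
  "h_trig_divdiff h m x f =
    (if odd m
     then 2 ^ (m - 1) * (coll_det m (\<lambda>c. if c = m then f else trig_int h c) x
                         / coll_det m (trig_half h) x)
     else 2 ^ m * (coll_det m (\<lambda>c. if c = m then f else trig_half h c) x
                   / coll_det m (trig_int h) x))"

text \<open>\<open>h_trunc_power h k x y\<close> is $\left(\sin_h \frac{y-x}{2}\right)_+^{k}$.\<close>

definition h_trunc_power :: "real \<Rightarrow> nat \<Rightarrow> real \<Rightarrow> real \<Rightarrow> complex" where
  "h_trunc_power h k x y =
    (if y > x then (\<Prod>l<k. h_sin h ((y - (x - real l * h)) / 2)) else 0)"

text \<open>$T_{0,m}(t; h)$ for the nodes \<open>x 0, \<dots>, x m\<close>.\<close>

definition h_trig_Bspline :: "real \<Rightarrow> nat \<Rightarrow> (nat \<Rightarrow> real) \<Rightarrow> real \<Rightarrow> complex" where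
  "h_trig_Bspline h m x t = h_trig_divdiff h m x (\<lambda>y. h_trunc_power h (m - 1) t y)"

text \<open>$A_h^k$; the superscript is an index, not an exponent.\<close>

definition A_const :: "real \<Rightarrow> nat \<Rightarrow> complex" where
  "A_const h k =
    (if k = 0 then 1
     else (h_exp h h / of_real h) ^ k * (\<Prod>l = 1..k. 1 - h_exp h (- (real l * h))))"

end

theory Submission
  imports Defs
begin

text \<open>
  Let \<open>E\<close> be the shift \<open>f \<mapsto> f (\<cdot> + h)\<close>. On the grid \<open>x 0 + h\<nat>\<close> both sides of the formula
  are polynomials in \<open>E\<close> applied to \<open>f\<close>, and the theorem is an identity between these
  polynomials.

  \<^item> The operator \<open>h_diff_op h m\<close> is \<open>P(E) / h^m\<close>, where
    \<open>P = (X - q\<^sub>0) \<cdots> (X - q\<^sub>m\<^sub>-\<^sub>1)\<close> has the roots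
    \<open>q\<^sub>j = h_exp h ((j - (m-1)/2) h)\<close> (\<open>h_diff_op_shift_op\<close>).

  \<^item> The divided difference has the form \<open>f \<mapsto> \<Sum>r\<le>m. w r * f (x r)\<close> and annihilates the
    \<open>m\<close> exponentials \<open>y \<mapsto> h_exp h ((j - (m-1)/2) y)\<close> (\<open>h_trig_divdiff_weights\<close>). With
    \<open>x r = x 0 + n r * h\<close> this says that \<open>W = \<Sum>r\<le>m. w r * X^(n r)\<close> vanishes at all the
    \<open>q\<^sub>j\<close>. The node span is less than a full period, so the \<open>q\<^sub>j\<close> are distinct, and
    hence \<open>W = Q P\<close> for some polynomial \<open>Q\<close>.

  \<^item> The truncated power is a discrete Green's function of \<open>P(E)\<close>: on the grid,
    \<open>P(E)\<close> turns it into a constant \<open>K\<close> times a unit impulse \<open>m - 1\<close> steps to the left of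
    its knot (\<open>shift_op_trunc_power\<close>).

  Applying \<open>W(E) = Q(E) P(E)\<close> to a truncated power with knot \<open>x 0 + k h\<close> therefore shows
  that the spline at that point is \<open>K\<close> times the coefficient of \<open>Q\<close> with index
  \<open>k - (m - 1)\<close>: the B-spline is the sequence of coefficients of \<open>Q\<close>. The
  \<open>h\<close>-integral of the spline against \<open>(P(E) f) (\<cdot> - (m-1) h)\<close> is then \<open>h K\<close> times
  \<open>Q(E) P(E) f = W(E) f\<close> at \<open>x 0\<close>, that is, a constant multiple of the divided
  difference of \<open>f\<close>. It remains to identify the constant, which is the evaluation of
  \<open>K\<close>, a product of sines, in \<open>A_const_eq\<close>.
\<close>

section \<open>The exponential function\<close>

lemma h_exp_add: "h_exp h (a + b) = h_exp h a * h_exp h b"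
  by (simp add: h_exp_def exp_add[symmetric] algebra_simps add_divide_distrib)

lemma h_exp_0 [simp]: "h_exp h 0 = 1"
  by (simp add: h_exp_def)

lemma h_exp_nonzero [simp]: "h_exp h a \<noteq> 0"
  by (simp add: h_exp_def)

lemma h_exp_mult_nat: "h_exp h (real n * a) = h_exp h a ^ n"
  by (induction n) (simp_all add: distrib_right h_exp_add)

lemma h_exp_sum: "h_exp h (\<Sum>i\<in>A. g i) = (\<Prod>i\<in>A. h_exp h (g i))"
  by (induction A rule: infinite_finite_induct) (simp_all add: h_exp_add)

lemma h_sin_0 [simp]: "h_sin h 0 = 0"
  by (simp add: h_sin_def)

lemma h_exp_cos_sin:
  "h_exp h a = h_cos h a + \<i> * h_sin h a" "h_exp h (- a) = h_cos h a - \<i> * h_sin h a"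
  by (simp_all add: h_cos_def h_sin_def field_simps)

lemma h_exp_neq_1:
  assumes "h > 0" "a > 0" "a * ln (1 + h) < 2 * pi"
  shows "h_exp h (a * h) \<noteq> 1"
proof
  assume "h_exp h (a * h) = 1"
  hence "cis (a * ln (1 + h)) = 1"
    using assms by (simp add: h_exp_def cis_conv_exp field_simps)
  hence "cos (a * ln (1 + h)) = 1"
    by (metis cis.sel(1) one_complex.sel(1))
  then obtain n :: int where n: "a * ln (1 + h) = n * (2 * pi)"
    by (auto simp: cos_one_2pi_int)
  have "a * ln (1 + h) > 0"
    using assms by simp
  hence "n > 0" by (simp add: n zero_less_mult_iff)
  moreover have "n < 1"
    using assms(3) unfolding n by (simp add: mult_less_cancel_right2)
  ultimately show False by linarith
qed

section \<open>Polynomials in the shift operator\<close>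

definition shift_op :: "real \<Rightarrow> complex poly \<Rightarrow> (real \<Rightarrow> complex) \<Rightarrow> real \<Rightarrow> complex" where
  "shift_op h p f y = (\<Sum>i\<le>degree p. coeff p i * f (y + real i * h))"

lemma shift_op_altdef:
  assumes "degree p \<le> n"
  shows "shift_op h p f y = (\<Sum>i\<le>n. coeff p i * f (y + real i * h))"
  unfolding shift_op_def using assms
  by (intro sum.mono_neutral_left) (auto simp: coeff_eq_0)

lemma shift_op_0 [simp]: "shift_op h 0 f y = 0"
  by (simp add: shift_op_def)

lemma shift_op_pCons: "shift_op h (pCons a p) f y = a * f y + shift_op h p f (y + h)"
proof -
  have "shift_op h (pCons a p) f y
      = (\<Sum>i\<le>Suc (degree p). coeff (pCons a p) i * f (y + real i * h))"
    by (rule shift_op_altdef) (simp add: degree_pCons_le)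
  also have "\<dots> = a * f y + (\<Sum>i\<le>degree p. coeff p i * f (y + real (Suc i) * h))"
    by (simp add: sum.atMost_Suc_shift del: sum.atMost_Suc of_nat_Suc)
  finally show ?thesis
    by (simp add: shift_op_def algebra_simps)
qed

lemma shift_op_add: "shift_op h (p + q) f y = shift_op h p f y + shift_op h q f y"
proof -
  define n where "n = max (degree p) (degree q)"
  have "degree (p + q) \<le> n" "degree p \<le> n" "degree q \<le> n"
    by (auto simp: n_def degree_add_le_max)
  thus ?thesis
    by (simp add: shift_op_altdef sum.distrib distrib_right)
qed

lemma shift_op_smult: "shift_op h (smult c p) f y = c * shift_op h p f y"
  by (simp add: shift_op_altdef[OF degree_smult_le] shift_op_def sum_distrib_left mult.assoc)

text \<open>Multiplication of polynomials becomes composition of operators; this turns the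
  factorisation of a polynomial into a statement about differences.\<close>

lemma shift_op_mult: "shift_op h (p * q) f y = shift_op h p (shift_op h q f) y"
  by (induction p arbitrary: y)
     (simp_all add: shift_op_pCons shift_op_add shift_op_smult)

lemma shift_op_monom: "shift_op h (monom c n) f y = c * f (y + real n * h)"
  by (induction n arbitrary: y)
     (simp_all add: monom_0 monom_Suc shift_op_pCons algebra_simps)

lemma shift_op_sum: "shift_op h (\<Sum>r\<in>A. p r) f y = (\<Sum>r\<in>A. shift_op h (p r) f y)"
  by (induction A rule: infinite_finite_induct) (simp_all add: shift_op_add)

text \<open>Exponentials are the eigenfunctions of the shift, so the roots of \<open>p\<close> tell which of them
  are annihilated, and conversely.\<close>

lemma shift_op_h_exp:
  "shift_op h p (\<lambda>y. h_exp h (s * y)) y = poly p (h_exp h (s * h)) * h_exp h (s * y)"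
  by (induction p arbitrary: y) (simp_all add: shift_op_pCons distrib_left h_exp_add algebra_simps)

lemma shift_op_lin:
  "shift_op h p (\<lambda>y. \<Sum>j\<in>A. c j * g j y) y = (\<Sum>j\<in>A. c j * shift_op h p (g j) y)"
  unfolding shift_op_def sum_distrib_left
  by (subst sum.swap) (simp add: mult_ac)

section \<open>The characteristic polynomial of the difference operator\<close>

definition char_root :: "real \<Rightarrow> nat \<Rightarrow> nat \<Rightarrow> complex" where
  "char_root h m j = h_exp h ((real j - (real m - 1) / 2) * h)"

definition char_poly_L :: "real \<Rightarrow> nat \<Rightarrow> complex poly" where
  "char_poly_L h m = (\<Prod>j<m. [:- char_root h m j, 1:])"

lemma poly_char_poly_L: "j < m \<Longrightarrow> poly (char_poly_L h m) (char_root h m j) = 0"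
  by (auto simp: char_poly_L_def poly_prod)

lemma degree_char_poly_L: "degree (char_poly_L h m) = m"
  by (simp add: char_poly_L_def degree_prod_eq_sum_degree)

lemma monic_char_poly_L: "coeff (char_poly_L h m) m = 1"
  using lead_coeff_prod[of "\<lambda>j. [:- char_root h m j, 1:]" "{..<m}"]
  by (simp add: char_poly_L_def[symmetric] degree_char_poly_L)

text \<open>Since \<open>h_deriv h\<close> is \<open>(E - 1) / h\<close>, subtracting \<open>(c - 1) / h\<close> leaves
  \<open>(E - c) / h\<close>.\<close>

lemma fold_h_factor:
  assumes "h \<noteq> 0"
  shows "fold (\<lambda>j. h_factor h ((c j - 1) / of_real h)) [0..<m] f y
       = shift_op h (\<Prod>j<m. [:- c j, 1:]) f y / of_real h ^ m"
proof (induction m arbitrary: y)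
  case 0
  show ?case by (simp add: shift_op_def)
next
  case (Suc m)
  define P where "P = (\<Prod>j<m. [:- c j, 1:])"
  have prod: "(\<Prod>j<Suc m. [:- c j, 1:]) = [:- c m, 1:] * P"
    by (simp only: P_def prod.lessThan_Suc mult.commute)
  have "fold (\<lambda>j. h_factor h ((c j - 1) / of_real h)) [0..<Suc m] f y
      = (shift_op h P f (y + h) - c m * shift_op h P f y) / of_real h ^ Suc m"
    using assms by (simp add: Suc.IH P_def[symmetric] h_factor_def h_deriv_def field_simps)
  also have "\<dots> = shift_op h (\<Prod>j<Suc m. [:- c j, 1:]) f y / of_real h ^ Suc m"
    unfolding prod shift_op_mult by (simp add: shift_op_pCons)
  finally show ?case .
qed

lemma h_diff_op_shift_op:
  "h \<noteq> 0 \<Longrightarrow> h_diff_op h m f y = shift_op h (char_poly_L h m) f y / of_real h ^ m"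
  unfolding h_diff_op_def char_poly_L_def char_root_def by (rule fold_h_factor)

lemma prod_linear_dvd:
  fixes p :: "complex poly" and c :: "nat \<Rightarrow> complex"
  assumes "inj_on c {..<m}" "\<And>j. j < m \<Longrightarrow> poly p (c j) = 0"
  shows "(\<Prod>j<m. [:- c j, 1:]) dvd p"
  using assms
proof (induction m)
  case (Suc m)
  have "(\<Prod>j<m. [:- c j, 1:]) dvd p"
    using Suc.prems by (intro Suc.IH) (auto simp: inj_on_def)
  then obtain q where q: "p = (\<Prod>j<m. [:- c j, 1:]) * q" ..
  have "poly (\<Prod>j<m. [:- c j, 1:]) (c m) \<noteq> 0"
    using inj_onD[OF Suc.prems(1)] by (force simp: poly_prod)
  moreover have "poly p (c m) = 0" using Suc.prems by simp
  ultimately have "poly q (c m) = 0" by (simp add: q)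
  hence "[:- c m, 1:] dvd q" by (simp add: poly_eq_0_iff_dvd)
  hence "(\<Prod>j<m. [:- c j, 1:]) * [:- c m, 1:] dvd p"
    unfolding q by (intro mult_dvd_mono dvd_refl)
  thus ?case by (simp only: prod.lessThan_Suc)
qed simp

section \<open>Truncated powers as discrete Green's functions\<close>

text \<open>Up to the factor \<open>h_exp h (- (y / 2))\<close>, each sine is affine in \<open>h_exp h y\<close>. So a product
  of \<open>k\<close> sines is \<open>h_exp h (- (k y / 2))\<close> times a polynomial of degree at most \<open>k\<close> in
  \<open>h_exp h y\<close>.\<close>

lemma sin_product_exponential_sum:
  "\<exists>c. \<forall>y. (\<Prod>l<k. h_sin h ((y - (t - real l * h)) / 2))
        = (\<Sum>j\<le>k. c j * h_exp h ((real j - real k / 2) * y))"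
proof -
  define a where "a l = h_exp h ((real l * h - t) / 2) / (2 * \<i>)" for l
  define b where "b l = - h_exp h (- ((real l * h - t) / 2)) / (2 * \<i>)" for l
  define p where "p = (\<Prod>l<k. [:b l, a l:])"
  have deg: "degree p \<le> k"
  proof -
    have "degree p \<le> sum (degree \<circ> (\<lambda>l. [:b l, a l:])) {..<k}"
      unfolding p_def by (rule degree_prod_sum_le) simp
    also have "\<dots> \<le> (\<Sum>l<k. 1)" by (rule sum_mono) (simp add: degree_pCons_le)
    finally show ?thesis by simp
  qed
  have fac: "h_sin h ((y - (t - real l * h)) / 2) = h_exp h (- (y / 2)) * poly [:b l, a l:] (h_exp h y)"
    for y l
  proof -
    have 1: "(y - (t - real l * h)) / 2 = - (y / 2) + ((real l * h - t) / 2 + y)"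
      "- ((y - (t - real l * h)) / 2) = - (y / 2) + - ((real l * h - t) / 2)"
      by (simp_all add: field_simps)
    show ?thesis
      unfolding h_sin_def 1(2) unfolding 1(1) h_exp_add a_def b_def
      by (simp add: field_simps)
  qed
  have "(\<Prod>l<k. h_sin h ((y - (t - real l * h)) / 2))
        = (\<Sum>j\<le>k. coeff p j * h_exp h ((real j - real k / 2) * y))" for y
  proof -
    have "(\<Prod>l<k. h_sin h ((y - (t - real l * h)) / 2)) = h_exp h (- (y / 2)) ^ k * poly p (h_exp h y)"
      unfolding fac p_def poly_prod prod.distrib by simp
    also have "h_exp h (- (y / 2)) ^ k = h_exp h (- (real k / 2 * y))"
      by (simp add: h_exp_mult_nat[symmetric])
    also have "poly p (h_exp h y) = (\<Sum>j\<le>k. coeff p j * h_exp h y ^ j)"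
      unfolding poly_altdef using deg
      by (intro sum.mono_neutral_left) (auto simp: coeff_eq_0)
    finally show ?thesis
      by (simp add: sum_distrib_left h_exp_mult_nat[symmetric] h_exp_add[symmetric] algebra_simps
          flip: mult.assoc)
        (simp add: mult.assoc h_exp_add[symmetric] algebra_simps)
  qed
  thus ?thesis by blast
qed

text \<open>A product of \<open>m - 1\<close> sines contains only the \<open>m\<close> frequencies \<open>j - (m-1)/2\<close> belonging to
  the characteristic roots.\<close>

lemma shift_op_sin_product:
  assumes "m \<ge> 1"
  shows "shift_op h (char_poly_L h m) (\<lambda>y. \<Prod>l<m - 1. h_sin h ((y - (t - real l * h)) / 2)) y = 0"
proof -
  obtain c where c: "\<And>y. (\<Prod>l<m - 1. h_sin h ((y - (t - real l * h)) / 2))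
        = (\<Sum>j\<le>m - 1. c j * h_exp h ((real j - real (m - 1) / 2) * y))"
    using sin_product_exponential_sum[where k = "m - 1"] by blast
  have "poly (char_poly_L h m) (h_exp h ((real j - real (m - 1) / 2) * h)) = 0" if "j \<le> m - 1" for j
    using poly_char_poly_L[of j m h] that assms by (simp add: char_root_def of_nat_diff)
  thus ?thesis
    unfolding c shift_op_lin shift_op_h_exp by simp
qed

text \<open>The sine product vanishes at the \<open>m - 1\<close> grid points \<open>t - (m-2) h, \<dots>, t\<close>, so from
  \<open>t - (m-2) h\<close> onwards truncation changes nothing and the operator gives \<open>0\<close>. Far to the
  left it sees only zeros. In between there is a single position, \<open>t - (m-1) h\<close>, where
  only the top coefficient of the monic polynomial meets the positive part, namely at
  \<open>t + h\<close>.\<close>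

lemma shift_op_trunc_power:
  fixes d :: int
  assumes "m \<ge> 1" "h > 0"
  shows "shift_op h (char_poly_L h m) (h_trunc_power h (m - 1) t) (t + of_int d * h)
       = (if d = 1 - int m then \<Prod>l<m - 1. h_sin h (real (Suc l) * h / 2) else 0)"
proof -
  let ?K = "\<lambda>y. \<Prod>l<m - 1. h_sin h ((y - (t - real l * h)) / 2)"
  have arg: "t + of_int d * h + real i * h = t + of_int (d + int i) * h" for i
    by (simp add: algebra_simps)
  have trunc: "h_trunc_power h (m - 1) t (t + of_int n * h) = (if n > 0 then ?K (t + of_int n * h) else 0)"
    for n :: int
    using assms(2) by (simp add: h_trunc_power_def zero_less_mult_iff)
  have expand: "shift_op h (char_poly_L h m) g (t + of_int d * h)
      = (\<Sum>i\<le>m. coeff (char_poly_L h m) i * g (t + of_int (d + int i) * h))" for g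
    unfolding shift_op_def degree_char_poly_L arg ..
  consider "d < 1 - int m" | "d = 1 - int m" | "d > 1 - int m" by linarith
  thus ?thesis
  proof cases
    case 1
    thus ?thesis unfolding expand trunc by (auto intro!: sum.neutral)
  next
    case 2
    have "shift_op h (char_poly_L h m) (h_trunc_power h (m - 1) t) (t + of_int d * h)
        = (\<Sum>i\<in>{m}. coeff (char_poly_L h m) i * h_trunc_power h (m - 1) t (t + of_int (d + int i) * h))"
      unfolding expand trunc using 2 by (intro sum.mono_neutral_right) auto
    also have "\<dots> = ?K (t + h)"
      unfolding trunc using 2 by (simp add: monic_char_poly_L)
    also have "\<dots> = (\<Prod>l<m - 1. h_sin h (real (Suc l) * h / 2))"
      by (intro prod.cong) (simp_all add: algebra_simps)
    finally show ?thesis using 2 by simp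
  next
    case 3
    \<comment> \<open>At a grid point on the truncated side, one factor of the untruncated product
      is \<open>h_sin h 0\<close>.\<close>
    have "h_trunc_power h (m - 1) t (t + of_int (d + int i) * h) = ?K (t + of_int (d + int i) * h)" for i
    proof (cases "d + int i > 0")
      case False
      define l where "l = nat (- (d + int i))"
      have l: "l < m - 1" "real l = - of_int (d + int i)"
        using False 3 by (auto simp: l_def)
      have "h_sin h ((t + of_int (d + int i) * h - (t - real l * h)) / 2) = 0"
        unfolding l(2) by (simp add: algebra_simps)
      hence "?K (t + of_int (d + int i) * h) = 0"
        using l(1) by (intro prod_zero) auto
      thus ?thesis unfolding trunc using False by (simp only: if_False)
    qed (simp only: trunc if_True)
    thus ?thesis
      using shift_op_sin_product[OF assms(1), of h t "t + of_int d * h"] 3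
      unfolding expand by simp
  qed
qed

text \<open>Pulling \<open>h_exp h (l h / 2) / (2 * \<i>)\<close> out of each sine leaves the factor
  \<open>1 - h_exp h (- (l h))\<close> of \<open>A_const\<close>, and the extracted exponents add up to
  \<open>m (m-1) h / 4\<close>. The normalising exponent in the theorem, \<open>- (m-1)(m-4) h / 4\<close>, is exactly
  what is missing from \<open>(m-1) h\<close>, the exponent contained in \<open>A_const\<close>.\<close>

lemma A_const_eq:
  assumes "h > 0" "m \<ge> 1"
  shows "A_const h (m - 1) = (2 * \<i>) ^ (m - 1) * h_exp h (- ((real m - 1) * (real m - 4) * h / 4))
     / of_real h ^ (m - 1) * (\<Prod>l<m - 1. h_sin h (real (Suc l) * h / 2))"
proof -
  define k where "k = m - 1"
  have m: "real m = real k + 1" using assms by (simp add: k_def)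
  have fac: "h_sin h (real (Suc l) * h / 2)
      = h_exp h (real (Suc l) * h / 2) * (1 - h_exp h (- (real (Suc l) * h))) / (2 * \<i>)" for l
  proof -
    have "h_exp h (- (real (Suc l) * h / 2)) = h_exp h (real (Suc l) * h / 2) * h_exp h (- (real (Suc l) * h))"
      unfolding h_exp_add[symmetric] by (rule arg_cong[of _ _ "h_exp h"]) simp
    thus ?thesis unfolding h_sin_def by (simp add: algebra_simps)
  qed
  have gauss: "(\<Sum>l<k. real (Suc l) * h / 2) = real k * (real k + 1) * h / 4"
    by (induction k) (simp_all add: field_simps)
  have shift: "(\<Prod>l = 1..k. 1 - h_exp h (- (real l * h))) = (\<Prod>l<k. 1 - h_exp h (- (real (Suc l) * h)))"
    by (rule prod.reindex_bij_witness[of _ Suc "\<lambda>l. l - 1"]) auto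
  have "h_exp h (- (real k * (real k - 3) * h / 4)) * h_exp h (real k * (real k + 1) * h / 4)
      = h_exp h (real k * h)"
    unfolding h_exp_add[symmetric] by (simp add: field_simps)
  hence e: "h_exp h (- (real k * (real k - 3) * h / 4)) * h_exp h (real k * (real k + 1) * h / 4)
      = h_exp h h ^ k" by (simp add: h_exp_mult_nat)
  have A: "A_const h k = (h_exp h h / of_real h) ^ k * (\<Prod>l<k. 1 - h_exp h (- (real (Suc l) * h)))"
    unfolding A_const_def shift by simp
  have "(2 * \<i>) ^ k * (\<Prod>l<k. h_sin h (real (Suc l) * h / 2))
     = h_exp h (real k * (real k + 1) * h / 4) * (\<Prod>l<k. 1 - h_exp h (- (real (Suc l) * h)))"
    unfolding fac prod.distrib prod_dividef h_exp_sum[symmetric] gauss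
    by simp
  hence "(2 * \<i>) ^ k * h_exp h (- (real k * (real k - 3) * h / 4))
     / of_real h ^ k * (\<Prod>l<k. h_sin h (real (Suc l) * h / 2)) = A_const h k"
    unfolding A power_divide e[symmetric]
    by (simp add: mult_ac)
  thus ?thesis unfolding k_def[symmetric] m by simp
qed

section \<open>The divided difference as a functional on the nodes\<close>

text \<open>Cofactors along the last column do not involve the function placed there.\<close>

lemma coll_det_last_column:
  "\<exists>w. \<forall>f. coll_det m (\<lambda>c. if c = m then f else \<phi> c) x = (\<Sum>r\<le>m. w r * f (x r))"
proof -
  define M where "M f = mat (m + 1) (m + 1) (\<lambda>(r, c). (if c = m then f else \<phi> c) (x r))" for f
  define w where "w r = cofactor (M (\<lambda>_. 0)) r m" for r
  have cof: "cofactor (M f) r m = w r" if "r \<le> m" for f r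
  proof -
    have "mat_delete (M f) r m = mat_delete (M (\<lambda>_. 0)) r m"
      by (auto simp: mat_delete_def M_def intro!: eq_matI)
    thus ?thesis by (simp add: w_def cofactor_def)
  qed
  have "coll_det m (\<lambda>c. if c = m then f else \<phi> c) x = (\<Sum>r\<le>m. w r * f (x r))" for f
  proof -
    have "det (M f) = (\<Sum>r<m + 1. M f $$ (r, m) * cofactor (M f) r m)"
      by (rule laplace_expansion_column) (auto simp: M_def)
    also have "\<dots> = (\<Sum>r\<le>m. w r * f (x r))"
      by (rule sum.cong) (auto simp: cof, auto simp: M_def)
    finally show ?thesis by (simp add: coll_det_def M_def)
  qed
  thus ?thesis by blast
qed

lemma coll_det_repeated_function:
  assumes "c < m"
  shows "coll_det m (\<lambda>i. if i = m then \<phi> c else \<phi> i) x = 0"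
  unfolding coll_det_def
  by (rule det_identical_columns[of _ "m + 1" c m])
     (use assms in \<open>auto intro!: eq_vecI\<close>)

text \<open>A function that already occurs as a column is annihilated, because the numerator then has
  two equal columns. The columns are a cosine and a sine for each frequency \<open>a\<close> (and the
  constant \<open>1\<close> if \<open>m\<close> is odd), which combine to the exponentials of frequencies \<open>a\<close> and
  \<open>- a\<close>. These are the frequencies \<open>j - (m-1)/2\<close>, integral for odd \<open>m\<close> and half-integral for
  even \<open>m\<close>.\<close>

lemma h_trig_divdiff_weights:
  obtains w where "\<And>f. h_trig_divdiff h m x f = (\<Sum>r\<le>m. w r * f (x r))"
    and "\<And>j. j < m \<Longrightarrow> (\<Sum>r\<le>m. w r * h_exp h ((real j - (real m - 1) / 2) * x r)) = 0"
proof -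
  define \<phi> where "\<phi> = (if odd m then trig_int h else trig_half h)"
  define C where "C = (if odd m then 2 ^ (m - 1) / coll_det m (trig_half h) x
                       else 2 ^ m / coll_det m (trig_int h) x)"
  have dd: "h_trig_divdiff h m x f = C * coll_det m (\<lambda>c. if c = m then f else \<phi> c) x" for f
    by (simp add: h_trig_divdiff_def \<phi>_def C_def cong: if_cong)
  obtain v where v: "\<And>f. coll_det m (\<lambda>c. if c = m then f else \<phi> c) x = (\<Sum>r\<le>m. v r * f (x r))"
    using coll_det_last_column[of m \<phi> x] by blast
  have kill: "(\<Sum>r\<le>m. v r * \<phi> c (x r)) = 0" if "c < m" for c
    using coll_det_repeated_function[OF that, of \<phi> x] by (simp add: v)
  have kill_pair: "(\<Sum>r\<le>m. v r * h_exp h (s * x r)) = 0"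
    if "c < m" "c' < m" "\<And>y. \<phi> c y = h_cos h (a * y)" "\<And>y. \<phi> c' y = h_sin h (a * y)"
       "s = a \<or> s = - a" for c c' s a
  proof -
    have "\<exists>e. \<forall>y. h_exp h (s * y) = h_cos h (a * y) + e * h_sin h (a * y)"
      using that(5)
    proof
      assume "s = a"
      thus ?thesis by (intro exI[of _ "\<i>"]) (simp add: h_exp_cos_sin(1))
    next
      assume "s = - a"
      thus ?thesis by (intro exI[of _ "- \<i>"]) (simp add: h_exp_cos_sin(2))
    qed
    then obtain e where e: "\<And>y. h_exp h (s * y) = h_cos h (a * y) + e * h_sin h (a * y)"
      by blast
    have "(\<Sum>r\<le>m. v r * h_exp h (s * x r))
        = (\<Sum>r\<le>m. v r * \<phi> c (x r)) + e * (\<Sum>r\<le>m. v r * \<phi> c' (x r))"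
      unfolding that(3,4) e sum_distrib_left sum.distrib[symmetric]
      by (simp add: algebra_simps)
    thus ?thesis using kill that(1,2) by simp
  qed
  have kill_exp: "(\<Sum>r\<le>m. v r * h_exp h ((real j - (real m - 1) / 2) * x r)) = 0" if j: "j < m" for j
  proof (cases "odd m")
    case True
    then obtain n where n: "m = 2 * n + 1" by (elim oddE)
    define s where "s = real j - (real m - 1) / 2"
    have s: "s = real j - real n" by (simp add: s_def n)
    define k where "k = (if j \<ge> n then j - n else n - j)"
    have k: "k \<le> n" "s = real k \<or> s = - real k"
      using j n by (auto simp: k_def s of_nat_diff)
    show ?thesis
    proof (cases "k = 0")
      case True
      hence "s = 0" using k by auto
      thus ?thesis unfolding s_def[symmetric]
        using kill[of 0] n by (simp add: \<phi>_def trig_int_def)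
    next
      case False
      show ?thesis unfolding s_def[symmetric]
      proof (rule kill_pair[of "2 * k - 1" "2 * k" "real k"])
        show "\<phi> (2 * k - 1) y = h_cos h (real k * y)" for y
          using False n by (auto simp: \<phi>_def trig_int_def)
        show "\<phi> (2 * k) y = h_sin h (real k * y)" for y
          using False n by (auto simp: \<phi>_def trig_int_def)
      qed (use False k n in auto)
    qed
  next
    case False
    then obtain n where n: "m = 2 * n" by blast
    define s where "s = real j - (real m - 1) / 2"
    have s: "s = real j - real n + 1 / 2" by (simp add: s_def n field_simps)
    define k where "k = (if j \<ge> n then j - n else n - Suc j)"
    have k: "k < n" "s = real k + 1 / 2 \<or> s = - (real k + 1 / 2)"
      using j n by (auto simp: k_def s of_nat_diff)
    show ?thesis unfolding s_def[symmetric]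
    proof (rule kill_pair[of "2 * k" "2 * k + 1" "real k + 1 / 2"])
      show "\<phi> (2 * k) y = h_cos h ((real k + 1 / 2) * y)" for y
        using False by (simp add: \<phi>_def trig_half_def)
      show "\<phi> (2 * k + 1) y = h_sin h ((real k + 1 / 2) * y)" for y
        using False by (simp add: \<phi>_def trig_half_def)
    qed (use k n in auto)
  qed
  show thesis
  proof (rule that[of "\<lambda>r. C * v r"])
    show "h_trig_divdiff h m x f = (\<Sum>r\<le>m. C * v r * f (x r))" for f
      by (simp add: dd v sum_distrib_left mult.assoc)
    show "(\<Sum>r\<le>m. C * v r * h_exp h ((real j - (real m - 1) / 2) * x r)) = 0" if "j < m" for j
      using kill_exp[OF that] by (simp add: mult.assoc sum_distrib_left[symmetric])
  qed
qed

section \<open>Consequences of the bound on the node span\<close>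

lemma inj_on_char_root:
  assumes "h > 0" "real m * ln (1 + h) < 2 * pi"
  shows "inj_on (char_root h m) {..<m}"
proof (rule linorder_inj_onI')
  fix i j assume ij: "i \<in> {..<m}" "j \<in> {..<m}" "i < j"
  have "char_root h m j = char_root h m i * h_exp h ((real j - real i) * h)"
    unfolding char_root_def h_exp_add[symmetric] by (simp add: algebra_simps)
  moreover have "h_exp h ((real j - real i) * h) \<noteq> 1"
  proof (rule h_exp_neq_1)
    have "(real j - real i) * ln (1 + h) \<le> real m * ln (1 + h)"
      using ij assms by (intro mult_right_mono) auto
    thus "(real j - real i) * ln (1 + h) < 2 * pi"
      using assms(2) by (rule le_less_trans)
  qed (use ij assms in auto)
  ultimately show "char_root h m i \<noteq> char_root h m j"
    by (auto simp: char_root_def)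
qed

lemma A_const_nonzero:
  assumes "h > 0" "real m * ln (1 + h) < 2 * pi"
  shows "A_const h (m - 1) \<noteq> 0"
proof -
  have "h_exp h (- (real l * h)) \<noteq> 1" if "l \<in> {1..m - 1}" for l
  proof -
    have "real l * ln (1 + h) \<le> real m * ln (1 + h)"
      using that assms by (intro mult_right_mono) auto
    hence "real l * ln (1 + h) < 2 * pi"
      using assms(2) by (rule le_less_trans)
    hence "h_exp h (real l * h) \<noteq> 1"
      using that assms(1) by (intro h_exp_neq_1) auto
    moreover have "h_exp h (real l * h) * h_exp h (- (real l * h)) = 1"
      by (simp add: h_exp_add[symmetric])
    ultimately show ?thesis by auto
  qed
  thus ?thesis using assms by (auto simp: A_const_def)
qed

section \<open>The integral representation\<close>

theorem theorem5p12:
  fixes h :: real and m :: nat and x :: "nat \<Rightarrow> real" and f :: "real \<Rightarrow> complex"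
  assumes "h \<noteq> 0" and "h > - 1"
    and "m \<ge> 1"
    and "\<And>j. j < m \<Longrightarrow> x j < x (Suc j)"
    and "x m - x 0 < 2 * pi * h / ln (1 + h)"
    and "\<And>j. j \<in> {1..m} \<Longrightarrow> (x j - x 0) / h \<in> \<nat>"
  shows "h_trig_divdiff h m x f =
    (2 * \<i>) ^ (m - 1) *
    (h_exp h (- ((real m - 1) * (real m - 4) * h / 4)) / A_const h (m - 1)) *
    h_integral h (x 0) (x m)
      (\<lambda>y. h_trig_Bspline h m x y * h_diff_op h m f (y - (real m - 1) * h))"
proof -
  \<comment> \<open>Since the nodes increase and lie in \<open>x 0 + h\<nat>\<close>, the step \<open>h\<close> is positive.\<close>
  have incr: "x 0 < x j" if "0 < j" "j \<le> m" for j
    using that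
  proof (induction j)
    case (Suc j)
    thus ?case using assms(4)[of j] by (cases "j = 0") auto
  qed simp
  have x0m: "x 0 < x m" using incr[of m] assms(3) by simp
  have "(x m - x 0) / h \<ge> 0" using assms(6)[of m] assms(3) by (auto elim: Nats_cases)
  hence h: "h > 0" using x0m assms(1) by (simp add: zero_le_divide_iff)

  have "\<exists>k. x j = x 0 + real k * h" if "j \<le> m" for j
  proof (cases "j = 0")
    case False
    hence "(x j - x 0) / h \<in> \<nat>" using assms(6)[of j] that by simp
    then obtain k where "(x j - x 0) / h = real k" by (elim Nats_cases)
    thus ?thesis using h by (intro exI[of _ k]) (simp add: field_simps)
  qed (auto intro: exI[of _ 0])
  then obtain n where n: "\<And>j. j \<le> m \<Longrightarrow> x j = x 0 + real (n j) * h" by metis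
  have step: "n j < n (Suc j)" if "j < m" for j
    using assms(4)[OF that] that h n[of j] n[of "Suc j"] by simp
  \<comment> \<open>The grid positions are strictly increasing integers, so \<open>m\<close> steps fit into the span of
    the nodes, which is shorter than a period.\<close>
  have n_le: "n j + (k - j) \<le> n k" if "j \<le> k" "k \<le> m" for j k
    using that
  proof (induction k rule: dec_induct)
    case (step k)
    thus ?case using \<open>\<And>j. j < m \<Longrightarrow> n j < n (Suc j)\<close>[of k] by simp
  qed simp
  have m_le: "m \<le> n m" using n_le[of 0 m] by simp
  have "real (n m) * ln (1 + h) < 2 * pi"
    using assms(5) h n[of m] by (simp add: field_simps)
  moreover have "real m * ln (1 + h) \<le> real (n m) * ln (1 + h)"
    using m_le h by (intro mult_right_mono) auto
  ultimately have angle: "real m * ln (1 + h) < 2 * pi" by linarith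

  \<comment> \<open>The divided difference is \<open>W(E)\<close> at \<open>x 0\<close>, and \<open>W\<close> vanishes at the characteristic
    roots.\<close>
  obtain w where w: "\<And>f. h_trig_divdiff h m x f = (\<Sum>r\<le>m. w r * f (x r))"
    and w0: "\<And>j. j < m \<Longrightarrow> (\<Sum>r\<le>m. w r * h_exp h ((real j - (real m - 1) / 2) * x r)) = 0"
    using h_trig_divdiff_weights by blast
  define W where "W = (\<Sum>r\<le>m. monom (w r) (n r))"
  have W: "h_trig_divdiff h m x g = shift_op h W g (x 0)" for g
    unfolding w W_def shift_op_sum shift_op_monom
    by (intro sum.cong refl arg_cong2[of _ _ _ _ "(*)"] arg_cong[of _ _ g] n) simp
  have "char_poly_L h m dvd W"
    unfolding char_poly_L_def
  proof (rule prod_linear_dvd[OF inj_on_char_root[OF h angle]])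
    fix j assume j: "j < m"
    show "poly W (char_root h m j) = 0"
      using w0[OF j] w[of "\<lambda>y. h_exp h ((real j - (real m - 1) / 2) * y)"]
      unfolding W shift_op_h_exp char_root_def by simp
  qed
  then obtain Q where Q: "W = Q * char_poly_L h m" by (metis dvdE mult.commute)
  \<comment> \<open>This bound keeps the impulses produced below inside the range of integration.\<close>
  have deg: "i + m \<le> n m" if "coeff Q i \<noteq> 0" for i
  proof -
    have "Q \<noteq> 0" using that by auto
    moreover have "char_poly_L h m \<noteq> 0" using monic_char_poly_L[of h m] by auto
    ultimately have "degree W = degree Q + m"
      by (simp add: Q degree_mult_eq degree_char_poly_L)
    moreover have "degree W \<le> n m"
      unfolding W_def
    proof (intro degree_sum_le)
      fix r assume "r \<in> {..m}"
      hence "n r \<le> n m" using n_le[of r m] by simp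
      thus "degree (monom (w r) (n r)) \<le> n m"
        by (rule order.trans[OF degree_monom_le])
    qed simp
    ultimately show ?thesis using le_degree[OF that] by linarith
  qed
  have dd: "h_trig_divdiff h m x g
      = (\<Sum>i\<le>degree Q. coeff Q i * shift_op h (char_poly_L h m) g (x 0 + real i * h))" for g
    unfolding W Q shift_op_mult by (simp add: shift_op_def[of h Q])

  define K where "K = (\<Prod>l<m - 1. h_sin h (real (Suc l) * h / 2))"
  \<comment> \<open>The B-spline is the coefficient sequence of \<open>Q\<close>, delayed by \<open>m - 1\<close> steps.\<close>
  have spline: "h_trig_Bspline h m x (x 0 + real k * h)
      = (\<Sum>i\<le>degree Q. if k = i + (m - 1) then K * coeff Q i else 0)" for k
  proof -
    have "shift_op h (char_poly_L h m) (h_trunc_power h (m - 1) (x 0 + real k * h)) (x 0 + real i * h)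
        = (if k = i + (m - 1) then K else 0)" for i
    proof -
      have pos: "x 0 + real i * h = (x 0 + real k * h) + of_int (int i - int k) * h"
        by (simp add: algebra_simps)
      have impulse: "int i - int k = 1 - int m \<longleftrightarrow> k = i + (m - 1)"
        using assms(3) by auto
      show ?thesis
        using shift_op_trunc_power[OF assms(3) h, of "x 0 + real k * h" "int i - int k"]
        by (simp only: pos impulse K_def)
    qed
    thus ?thesis
      unfolding h_trig_Bspline_def dd by (intro sum.cong) auto
  qed

  let ?L = "\<lambda>y. shift_op h (char_poly_L h m) f y"
  have floor: "nat \<lfloor>(x m - x 0) / h\<rfloor> = n m" using h n[of m] by simp
  have summand: "h_trig_Bspline h m x (x 0 + real k * h)
        * h_diff_op h m f (x 0 + real k * h - (real m - 1) * h)
      = (\<Sum>i\<le>degree Q. if k = i + (m - 1)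
          then K * coeff Q i * (?L (x 0 + real i * h) / of_real h ^ m) else 0)" for k
    unfolding spline h_diff_op_shift_op[OF assms(1)] sum_distrib_right
    using assms(3) by (intro sum.cong) (auto simp: of_nat_diff algebra_simps)
  have "h_integral h (x 0) (x m)
      (\<lambda>y. h_trig_Bspline h m x y * h_diff_op h m f (y - (real m - 1) * h))
    = of_real h * (\<Sum>k<n m. \<Sum>i\<le>degree Q. if k = i + (m - 1)
        then K * coeff Q i * (?L (x 0 + real i * h) / of_real h ^ m) else 0)"
    unfolding h_integral_def floor summand using x0m by simp
  also have "\<dots> = of_real h * (\<Sum>i\<le>degree Q. \<Sum>k<n m. if k = i + (m - 1)
        then K * coeff Q i * (?L (x 0 + real i * h) / of_real h ^ m) else 0)"
    by (subst sum.swap) simp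
  also have "\<dots> = of_real h * (\<Sum>i\<le>degree Q. K * coeff Q i * (?L (x 0 + real i * h) / of_real h ^ m))"
    using deg assms(3) by (intro arg_cong[of _ _ "(*) _"] sum.cong) force+
  also have "\<dots> = K / of_real h ^ (m - 1) * h_trig_divdiff h m x f"
    using h assms(3) unfolding dd
    by (cases m) (simp_all add: sum_distrib_left sum_divide_distrib mult_ac)
  finally have int: "h_integral h (x 0) (x m)
      (\<lambda>y. h_trig_Bspline h m x y * h_diff_op h m f (y - (real m - 1) * h))
    = K / of_real h ^ (m - 1) * h_trig_divdiff h m x f" .
  have "A_const h (m - 1) \<noteq> 0" by (rule A_const_nonzero[OF h angle])
  thus ?thesis
    unfolding int using A_const_eq[OF h assms(3)] unfolding K_def[symmetric]
    by (simp add: field_simps)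
qed

end
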